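(* For the parameters $(A,B,C,D)=(0,0,0,4)$ the following hold: (i) $\mathcal{J}_{0,0,0,4}=S_{0,0,0,4}$, and consequently $\mathcal{F}_{0,0,0,4}=\emptyset$; (ii) the action of $\mathcal{G}_{0,0,0,4}$ is locally discrete on any (non-empty) open subset of $S_{0,0,0,4}$; (iii) the closure of the set $\mathcal{J}^*_{0,0,0,4}$ of points that have hyperbolic stabilizers is contained in $S_{0,0,0,4}\cap[-2,2]^3$, and hence is a proper subset of $\mathcal{J}_{0,0,0,4}=S_{0,0,0,4}$.
   Context: For $(A,B,C,D)\in\mathbb{C}^4$ let $S_{A,B,C,D}=\{(x,y,z)\in\mathbb{C}^3: x^2+y^2+z^2+xyz=Ax+By+Cz+D\}$. The involutions $s_x(x,y,z)=(-x-yz+A,\,y,\,z)$, $s_y(x,y,z)=(x,\,-y-xz+B,\,z)$, $s_z(x,y,z)=(x,\,y,\,-z-xy+C)$ preserve $S_{A,B,C,D}$. Let $\mathcal{G}_{A,B,C,D}=\langle g_x,g_y,g_z\rangle$ be the group of automorphisms of $S_{A,B,C,D}$ generated by $g_x=s_z\circ s_y$, $g_y=s_x\circ s_z$, $g_z=s_y\circ s_x$. A sequence of maps $f_i$ converges to infinity on an open set $U\subset S_{A,B,C,D}$ if for every compact $\overline V\subset U$ and every compact $K\subset S_{A,B,C,D}$ only finitely many $i$ satisfy $f_i(\overline V)\cap K\neq\emptyset$. The group $\mathcal{G}_{A,B,C,D}$ forms a normal family on $U$ if every sequence of its elements has a subsequence that, on $U$, either converges uniformly on compact subsets or converges to infinity.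 The Fatou set $\mathcal{F}_{A,B,C,D}$ is the set of $p\in S_{A,B,C,D}$ having an open neighborhood on which $\mathcal{G}_{A,B,C,D}$ forms a normal family; the Julia set is $\mathcal{J}_{A,B,C,D}=S_{A,B,C,D}\setminus\mathcal{F}_{A,B,C,D}$. The group $\mathcal{G}_{A,B,C,D}$ is locally non-discrete on an open set $U\subset S_{A,B,C,D}$ if there is a sequence $f_n\in\mathcal{G}_{A,B,C,D}\setminus\{\mathrm{id}\}$ converging uniformly to the identity on compact subsets of $U$; otherwise it is locally discrete on $U$. A point $p$ has hyperbolic stabilizer, i.e. $p\in\mathcal{J}^*_{A,B,C,D}$, if $p\in\mathcal{J}_{A,B,C,D}$ and there is $\gamma\in\mathcal{G}_{A,B,C,D}$ with $\gamma(p)=p$ such that the derivative $D\gamma(p)$ of $\gamma$ on the tangent space of $S_{A,B,C,D}$ at $p$ (the Zariski tangent space if $p$ is singular) is hyperbolic, i.e. has no eigenvalue of modulus $1$. *)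

theory Defs
  imports "HOL-Analysis.Analysis" "HOL-Algebra.Bij" "HOL-Algebra.Generated_Groups"
begin

definition cubic_surface :: "complex \<Rightarrow> complex \<Rightarrow> complex \<Rightarrow> complex \<Rightarrow> (complex^3) set" where
  "cubic_surface A B C D =
     {p. (p$1)^2 + (p$2)^2 + (p$3)^2 + p$1 * p$2 * p$3 = A * p$1 + B * p$2 + C * p$3 + D}"

definition inv_x :: "complex \<Rightarrow> complex^3 \<Rightarrow> complex^3" where
  "inv_x A p = vector [- p$1 - p$2 * p$3 + A, p$2, p$3]"

definition inv_y :: "complex \<Rightarrow> complex^3 \<Rightarrow> complex^3" where
  "inv_y B p = vector [p$1, - p$2 - p$1 * p$3 + B, p$3]"

definition inv_z :: "complex \<Rightarrow> complex^3 \<Rightarrow> complex^3" where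
  "inv_z C p = vector [p$1, p$2, - p$3 - p$1 * p$2 + C]"

text \<open>The generators are restricted to the surface, so that the group below consists of
  bijections of the surface and not of the ambient space.\<close>

definition gen_x :: "complex \<Rightarrow> complex \<Rightarrow> complex \<Rightarrow> complex \<Rightarrow> complex^3 \<Rightarrow> complex^3" where
  "gen_x A B C D = restrict (inv_z C \<circ> inv_y B) (cubic_surface A B C D)"

definition gen_y :: "complex \<Rightarrow> complex \<Rightarrow> complex \<Rightarrow> complex \<Rightarrow> complex^3 \<Rightarrow> complex^3" where
  "gen_y A B C D = restrict (inv_x A \<circ> inv_z C) (cubic_surface A B C D)"

definition gen_z :: "complex \<Rightarrow> complex \<Rightarrow> complex \<Rightarrow> complex \<Rightarrow> complex^3 \<Rightarrow> complex^3" where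
  "gen_z A B C D = restrict (inv_y B \<circ> inv_x A) (cubic_surface A B C D)"

definition cubic_group ::
    "complex \<Rightarrow> complex \<Rightarrow> complex \<Rightarrow> complex \<Rightarrow> (complex^3 \<Rightarrow> complex^3) set" where
  "cubic_group A B C D =
     generate (BijGroup (cubic_surface A B C D)) {gen_x A B C D, gen_y A B C D, gen_z A B C D}"

lemma inv_involutive [simp]:
  "inv_x A (inv_x A p) = p" "inv_y B (inv_y B p) = p" "inv_z C (inv_z C p) = p"
  by (simp_all add: vec_eq_iff forall_3 inv_x_def inv_y_def inv_z_def)

lemma inv_in_cubic_surface:
  assumes "p \<in> cubic_surface A B C D"
  shows "inv_x A p \<in> cubic_surface A B C D" "inv_y B p \<in> cubic_surface A B C D"
    "inv_z C p \<in> cubic_surface A B C D"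
  using assms
  by (simp_all add: cubic_surface_def inv_x_def inv_y_def inv_z_def power2_eq_square) algebra+

lemma inv_bij_betw:
  "bij_betw (inv_x A) (cubic_surface A B C D) (cubic_surface A B C D)"
  "bij_betw (inv_y B) (cubic_surface A B C D) (cubic_surface A B C D)"
  "bij_betw (inv_z C) (cubic_surface A B C D) (cubic_surface A B C D)"
  by (rule bij_betw_byWitness[where f' = "inv_x A"] bij_betw_byWitness[where f' = "inv_y B"]
        bij_betw_byWitness[where f' = "inv_z C"]; auto simp: inv_in_cubic_surface)+

lemma generators_in_carrier:
  "{gen_x A B C D, gen_y A B C D, gen_z A B C D} \<subseteq> carrier (BijGroup (cubic_surface A B C D))"
  by (auto simp: BijGroup_def Bij_def gen_x_def gen_y_def gen_z_def
      intro!: bij_betw_trans[OF inv_bij_betw(2) inv_bij_betw(3)]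
        bij_betw_trans[OF inv_bij_betw(3) inv_bij_betw(1)]
        bij_betw_trans[OF inv_bij_betw(1) inv_bij_betw(2)])

definition converges_locally_uniformly_on ::
    "(complex^3) set \<Rightarrow> (nat \<Rightarrow> complex^3 \<Rightarrow> complex^3) \<Rightarrow> (complex^3 \<Rightarrow> complex^3) \<Rightarrow> bool" where
  "converges_locally_uniformly_on U f g \<longleftrightarrow>
     (\<forall>V. compact V \<and> V \<subseteq> U \<longrightarrow> uniform_limit V f g sequentially)"

definition converges_to_infinity_on ::
    "(complex^3) set \<Rightarrow> (complex^3) set \<Rightarrow> (nat \<Rightarrow> complex^3 \<Rightarrow> complex^3) \<Rightarrow> bool" where
  "converges_to_infinity_on S U f \<longleftrightarrow>
     (\<forall>V K. compact V \<and> V \<subseteq> U \<and> compact K \<and> K \<subseteq> S \<longrightarrow> finite {i. f i ` V \<inter> K \<noteq> {}})"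

definition normal_on ::
    "complex \<Rightarrow> complex \<Rightarrow> complex \<Rightarrow> complex \<Rightarrow> (complex^3) set \<Rightarrow> bool" where
  "normal_on A B C D U \<longleftrightarrow>
     (\<forall>f. range f \<subseteq> cubic_group A B C D \<longrightarrow>
       (\<exists>r :: nat \<Rightarrow> nat. strict_mono r \<and>
         ((\<exists>g. converges_locally_uniformly_on U (f \<circ> r) g) \<or>
          converges_to_infinity_on (cubic_surface A B C D) U (f \<circ> r))))"

definition fatou_set :: "complex \<Rightarrow> complex \<Rightarrow> complex \<Rightarrow> complex \<Rightarrow> (complex^3) set" where
  "fatou_set A B C D =
     {p. \<exists>U. openin (top_of_set (cubic_surface A B C D)) U \<and> p \<in> U \<and> normal_on A B C D U}"

definition julia_set :: "complex \<Rightarrow> complex \<Rightarrow> complex \<Rightarrow> complex \<Rightarrow> (complex^3) set" where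
  "julia_set A B C D = cubic_surface A B C D - fatou_set A B C D"

definition locally_nondiscrete_on ::
    "complex \<Rightarrow> complex \<Rightarrow> complex \<Rightarrow> complex \<Rightarrow> (complex^3) set \<Rightarrow> bool" where
  "locally_nondiscrete_on A B C D U \<longleftrightarrow>
     (\<exists>f. range f \<subseteq> cubic_group A B C D - {\<one>\<^bsub>BijGroup (cubic_surface A B C D)\<^esub>} \<and>
       converges_locally_uniformly_on U f (\<lambda>p. p))"

abbreviation locally_discrete_on ::
    "complex \<Rightarrow> complex \<Rightarrow> complex \<Rightarrow> complex \<Rightarrow> (complex^3) set \<Rightarrow> bool" where
  "locally_discrete_on A B C D U \<equiv> \<not> locally_nondiscrete_on A B C D U"

inductive polynomial_fun :: "(complex^3 \<Rightarrow> complex) \<Rightarrow> bool" where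
  const: "polynomial_fun (\<lambda>p. c)"
| coord: "polynomial_fun (\<lambda>p. p $ i)"
| add: "polynomial_fun f \<Longrightarrow> polynomial_fun g \<Longrightarrow> polynomial_fun (\<lambda>p. f p + g p)"
| mult: "polynomial_fun f \<Longrightarrow> polynomial_fun g \<Longrightarrow> polynomial_fun (\<lambda>p. f p * g p)"

definition polynomial_map :: "(complex^3 \<Rightarrow> complex^3) \<Rightarrow> bool" where
  "polynomial_map f \<longleftrightarrow> (\<forall>i. polynomial_fun (\<lambda>p. f p $ i))"

definition zariski_tangent_space :: "(complex^3) set \<Rightarrow> complex^3 \<Rightarrow> (complex^3) set" where
  "zariski_tangent_space S p =
     {v. \<forall>h. polynomial_fun h \<and> (\<forall>q\<in>S. h q = 0) \<longrightarrow> frechet_derivative h (at p) v = 0}"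

text \<open>A regular map of a closed subset \<open>S\<close> is the restriction of a polynomial map; its derivative on
  the Zariski tangent space is induced by the derivative of any polynomial extension. The relation
  below determines \<open>L\<close> only on the Zariski tangent space, see \<open>regular_derivative_unique\<close>.\<close>

definition has_regular_derivative ::
    "(complex^3 \<Rightarrow> complex^3) \<Rightarrow> (complex^3 \<Rightarrow> complex^3) \<Rightarrow> (complex^3) set \<Rightarrow> complex^3 \<Rightarrow> bool" where
  "has_regular_derivative \<gamma> L S p \<longleftrightarrow>
     (\<exists>f. polynomial_map f \<and> (\<forall>q\<in>S. f q = \<gamma> q) \<and> (f has_derivative L) (at p))"

lemma regular_derivative_unique:
  assumes "has_regular_derivative \<gamma> L S p" "has_regular_derivative \<gamma> L' S p"
    and v: "v \<in> zariski_tangent_space S p"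
  shows "L v = L' v"
proof -
  obtain f f' where f: "polynomial_map f" "\<forall>q\<in>S. f q = \<gamma> q" "(f has_derivative L) (at p)"
    and f': "polynomial_map f'" "\<forall>q\<in>S. f' q = \<gamma> q" "(f' has_derivative L') (at p)"
    using assms by (auto simp: has_regular_derivative_def)
  have "L v $ i = L' v $ i" for i
  proof -
    define h where "h = (\<lambda>q. f q $ i + (-1) * f' q $ i)"
    have "polynomial_fun h"
      unfolding h_def using f(1) f'(1)
      unfolding polynomial_map_def
      by (intro polynomial_fun.add polynomial_fun.mult polynomial_fun.const) blast+
    moreover have "\<forall>q\<in>S. h q = 0"
      using f(2) f'(2) by (simp add: h_def)
    ultimately have "frechet_derivative h (at p) v = 0"
      using v by (simp add: zariski_tangent_space_def)
    moreover have "(h has_derivative (\<lambda>v. L v $ i + (-1) * L' v $ i)) (at p)"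
      unfolding h_def
      by (intro has_derivative_add has_derivative_mult_right
          bounded_linear.has_derivative[OF bounded_linear_vec_nth] f(3) f'(3))
    ultimately show ?thesis
      by (simp flip: frechet_derivative_at)
  qed
  then show ?thesis by (simp add: vec_eq_iff)
qed

definition hyperbolic_on :: "(complex^3) set \<Rightarrow> (complex^3 \<Rightarrow> complex^3) \<Rightarrow> bool" where
  "hyperbolic_on T L \<longleftrightarrow> (\<forall>\<mu> v. v \<in> T \<and> v \<noteq> 0 \<and> L v = \<mu> *s v \<longrightarrow> norm \<mu> \<noteq> 1)"

definition hyperbolic_stabilizer_set ::
    "complex \<Rightarrow> complex \<Rightarrow> complex \<Rightarrow> complex \<Rightarrow> (complex^3) set" where
  "hyperbolic_stabilizer_set A B C D =
     {p \<in> julia_set A B C D. \<exists>\<gamma> \<in> cubic_group A B C D. \<gamma> p = p \<and>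
       (\<exists>L. has_regular_derivative \<gamma> L (cubic_surface A B C D) p \<and>
            hyperbolic_on (zariski_tangent_space (cubic_surface A B C D) p) L)}"

definition real_cube :: "(complex^3) set" where
  "real_cube = {p. \<forall>i. p $ i \<in> complex_of_real ` {-2..2}}"

end

theory Submission imports Defs begin

text \<open>The Cayley cubic is a quotient of \<open>(\<complex>\<^sup>*)\<^sup>2\<close>: the map \<open>(s, t) \<mapsto> (-2 cosh s, -2 cosh t, -2 cosh (s + t))\<close>
  is onto, and through it the group acts on \<open>(s, t)\<close> by integer matrices, hence also on the real
  parts \<open>(Re s, Re t)\<close>, which the surface determines up to a common sign.

  (i) Points whose real parts are rational are dense. A Euclidean descent \<open>(m, n) \<mapsto> (m \<plusminus> 2n, n)\<close>,
  \<open>(m, n \<plusminus> 2m)\<close> moves such a point to one with \<open>Re s = 0\<close>, \<open>Re t = 0\<close> or \<open>Re (s + t) = 0\<close>. There the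
  powers of one of the three parabolic generators are bounded, but they are unbounded at nearby
  points, so no subsequence converges to a map or to infinity.

  (ii) If \<open>f\<^sub>k\<close> converges to the identity at a point with real parts in \<open>(1/N) \<int>\<close>, discreteness forces
  its matrix to fix these real parts up to sign for large \<open>k\<close>. Three such points in general position
  force the matrix to be \<open>\<plusminus>1\<close>.

  (iii) If \<open>\<gamma>\<close> fixes the image of \<open>(s, t)\<close>, it fixes the image of \<open>(s, t) + x (Re s, Re t)\<close> for every
  real \<open>x\<close>. Unless both real parts vanish, this is a curve through the point with nonzero velocity,
  and \<open>D\<gamma>\<close> has the eigenvalue \<open>1\<close>.\<close>

section \<open>Parametrization by hyperbolic cosines\<close>

abbreviation cayley :: "(complex^3) set" where "cayley \<equiv> cubic_surface 0 0 0 4"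

definition cayley_param :: "complex \<Rightarrow> complex \<Rightarrow> complex^3" where
  "cayley_param s t = vector [-2 * cosh s, -2 * cosh t, -2 * cosh (s + t)]"

lemma cayley_param_nth [simp]:
  "cayley_param s t $ 1 = -2 * cosh s"
  "cayley_param s t $ 2 = -2 * cosh t"
  "cayley_param s t $ 3 = -2 * cosh (s + t)"
  by (simp_all add: cayley_param_def)

text \<open>This is the common sign that the surface cannot see; it is the source of every "up to
  sign" below.\<close>

lemma cayley_param_minus: "cayley_param (- s) (- t) = cayley_param s t"
proof -
  have "cosh (- s - t) = cosh (s + t)"
    using cosh_minus[of "s + t"] by (simp del: cosh_minus)
  then show ?thesis by (simp add: cayley_param_def)
qed

lemma cosh_add_diff: "cosh (s + t) + cosh (s - t) = 2 * cosh s * cosh (t::complex)"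
  by (simp add: cosh_add cosh_diff)

lemma cosh_add_mult_diff: "cosh (s + t) * cosh (s - t) = cosh s ^ 2 + cosh (t::complex) ^ 2 - 1"
proof -
  have "cosh (s + t) * cosh (s - t) = cosh s ^ 2 * cosh t ^ 2 - sinh s ^ 2 * sinh t ^ 2"
    by (simp add: cosh_add cosh_diff power2_eq_square algebra_simps)
  also have "\<dots> = cosh s ^ 2 + cosh t ^ 2 - 1"
    by (simp add: cosh_square_eq algebra_simps)
  finally show ?thesis .
qed

text \<open>With the first two coordinates \<open>-2 * cosh s\<close> and \<open>-2 * cosh t\<close>
  fixed, the equation of the surface is quadratic in the third, and this finds its two roots. One
  root puts the parametrization on the surface; the other is the same root with \<open>-t\<close>
  for \<open>t\<close>, which gives surjectivity.\<close>

lemma cayley_factor: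
  "4 * cosh s ^ 2 + 4 * cosh t ^ 2 + z ^ 2 + 4 * cosh s * cosh t * z - 4
     = (z + 2 * cosh (s + t)) * (z + 2 * cosh (s - t))" for s t z :: complex
proof -
  have "(z + 2 * cosh (s + t)) * (z + 2 * cosh (s - t))
      = z ^ 2 + 2 * z * (cosh (s + t) + cosh (s - t)) + 4 * (cosh (s + t) * cosh (s - t))"
    by (simp add: power2_eq_square algebra_simps)
  also have "\<dots> = z ^ 2 + 2 * z * (2 * cosh s * cosh t) + 4 * (cosh s ^ 2 + cosh t ^ 2 - 1)"
    unfolding cosh_add_diff cosh_add_mult_diff ..
  finally show ?thesis by (simp add: algebra_simps)
qed

lemma in_cayley_iff:
  "p \<in> cayley \<longleftrightarrow> (p$1)^2 + (p$2)^2 + (p$3)^2 + p$1 * p$2 * p$3 = 4"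
  by (simp add: cubic_surface_def)

lemma cayley_param_in [simp]: "cayley_param s t \<in> cayley"
  using cayley_factor[of s t "-2 * cosh (s + t)"]
  by (simp add: in_cayley_iff power_mult_distrib algebra_simps)

lemma cosh_surj: "\<exists>s. cosh s = (z::complex)"
  using cosh_conv_cos[of "- \<i> * Arccos z"] by (metis cos_Arccos mult_minus_left minus_minus
      mult.assoc mult.left_neutral complex_i_mult_minus cosh_conv_cos)

lemma cayley_param_surj:
  assumes "p \<in> cayley" obtains s t where "p = cayley_param s t"
proof -
  obtain s where s: "cosh s = - p$1 / 2" using cosh_surj by blast
  obtain t where t: "cosh t = - p$2 / 2" using cosh_surj by blast
  have "(p$3 + 2 * cosh (s + t)) * (p$3 + 2 * cosh (s - t)) = 0"
    using assms unfolding cayley_factor[symmetric] s t in_cayley_iff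
    by (simp add: power_divide algebra_simps)
  then have "p$3 = -2 * cosh (s + t) \<or> p$3 = -2 * cosh (s + - t)"
    by (auto simp: add_eq_0_iff2)
  then have "p = cayley_param s t \<or> p = cayley_param s (- t)"
    using s t by (auto simp: vec_eq_iff forall_3)
  then show ?thesis using that by blast
qed

text \<open>An involution exchanges the two roots of the quadratic in its coordinate. For the first
  coordinate these come from the difference and the sum of \<open>s + t\<close> and
  \<open>t\<close>, that is, from \<open>s\<close> and \<open>s + 2 * t\<close>.\<close>

lemma inv_x_cayley_param: "inv_x 0 (cayley_param s t) = cayley_param (s + 2 * t) (- t)"
  using arg_cong[OF cosh_add_diff[of "s + t" t], of "\<lambda>z. 2 * z"]
  by (simp add: vec_eq_iff forall_3 inv_x_def algebra_simps flip: mult_2)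

lemma inv_y_cayley_param: "inv_y 0 (cayley_param s t) = cayley_param (- s) (2 * s + t)"
  using arg_cong[OF cosh_add_diff[of "s + t" s], of "\<lambda>z. 2 * z"]
  by (simp add: vec_eq_iff forall_3 inv_y_def algebra_simps flip: mult_2)

lemma inv_z_cayley_param: "inv_z 0 (cayley_param s t) = cayley_param s (- t)"
  using arg_cong[OF cosh_add_diff[of s t], of "\<lambda>z. 2 * z"]
  by (simp add: vec_eq_iff forall_3 inv_z_def algebra_simps)

section \<open>The group and its integral matrices\<close>

abbreviation gx where "gx \<equiv> gen_x 0 0 0 4"
abbreviation gy where "gy \<equiv> gen_y 0 0 0 4"
abbreviation gz where "gz \<equiv> gen_z 0 0 0 4"

text \<open>Each generator is a transvection: it displaces \<open>(s, t)\<close> by a multiple of a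
  linear form (\<open>s\<close>, \<open>t\<close> or \<open>s + t\<close>) that it preserves. The
  third formula is left unsimplified to show this. For \<open>gx\<close> the composed involutions
  give the negated pair, hence the use of \<open>cayley_param_minus\<close>.\<close>

lemma gen_cayley_param:
  "gx (cayley_param s t) = cayley_param s (t + 2 * s)"
  "gy (cayley_param s t) = cayley_param (s - 2 * t) t"
  "gz (cayley_param s t) = cayley_param (s - 2 * (s + t)) (t + 2 * (s + t))"
  using cayley_param_minus[of "s" "2 * s + t"]
  by (simp_all add: gen_x_def gen_y_def gen_z_def inv_x_cayley_param inv_y_cayley_param
      inv_z_cayley_param algebra_simps)

abbreviation "BG \<equiv> BijGroup cayley"
abbreviation "CG \<equiv> cubic_group 0 0 0 4"

lemma group_BG: "group BG"
  by (rule group_BijGroup)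

lemma subgroup_CG: "subgroup CG BG"
  unfolding cubic_group_def by (rule group.generate_is_subgroup[OF group_BG generators_in_carrier])

lemma gen_in_CG: "gx \<in> CG" "gy \<in> CG" "gz \<in> CG"
  unfolding cubic_group_def by (auto intro: generate.incl)

lemma CG_Bij: "f \<in> CG \<Longrightarrow> f \<in> Bij cayley"
  using subgroup.subset[OF subgroup_CG] by (auto simp: BijGroup_def)

lemma CG_maps: "f \<in> CG \<Longrightarrow> p \<in> cayley \<Longrightarrow> f p \<in> cayley"
  using CG_Bij by (auto simp: Bij_def bij_betw_def)

lemma mult_CG:
  assumes "f \<in> CG" "g \<in> CG"
  shows "f \<otimes>\<^bsub>BG\<^esub> g \<in> CG" "p \<in> cayley \<Longrightarrow> (f \<otimes>\<^bsub>BG\<^esub> g) p = f (g p)"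
  using assms subgroup.m_closed[OF subgroup_CG]
  by (auto simp: BijGroup_def CG_Bij compose_eq)

lemma inv_CG_eq:
  assumes "f \<in> CG" "p \<in> cayley" "f p = q"
  shows "(inv\<^bsub>BG\<^esub> f) q = p"
proof -
  have "q \<in> cayley" using CG_maps assms by blast
  moreover have "inj_on f cayley" using CG_Bij[OF assms(1)] by (auto simp: Bij_def bij_betw_def)
  ultimately show ?thesis
    using assms by (simp add: inv_BijGroup CG_Bij inv_into_f_eq)
qed

lemma inv_CG:
  assumes "f \<in> CG"
  shows "inv\<^bsub>BG\<^esub> f \<in> CG" "p \<in> cayley \<Longrightarrow> f ((inv\<^bsub>BG\<^esub> f) p) = p"
proof -
  show "inv\<^bsub>BG\<^esub> f \<in> CG" by (rule subgroup.m_inv_closed[OF subgroup_CG assms])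
  assume p: "p \<in> cayley"
  then obtain q where "q \<in> cayley" "f q = p"
    using CG_Bij[OF assms] by (auto simp: Bij_def bij_betw_def elim!: equalityE)
  then show "f ((inv\<^bsub>BG\<^esub> f) p) = p" using inv_CG_eq[OF assms] by simp
qed

lemma one_BG: "\<one>\<^bsub>BG\<^esub> = (\<lambda>p\<in>cayley. p)"
  by (simp add: BijGroup_def)

lemma CG_eq_one:
  assumes "f \<in> CG" "\<And>p. p \<in> cayley \<Longrightarrow> f p = p"
  shows "f = \<one>\<^bsub>BG\<^esub>"
  unfolding one_BG
proof (rule extensionalityI)
  show "f \<in> extensional cayley" using CG_Bij[OF assms(1)] by (simp add: Bij_def)
qed (use assms(2) in auto)

lemma CG_induct [consumes 1, case_names one gen inv_gen mult]:
  assumes "f \<in> CG"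
    and "P \<one>\<^bsub>BG\<^esub>"
    and "\<And>h. h \<in> {gx, gy, gz} \<Longrightarrow> P h"
    and "\<And>h. h \<in> {gx, gy, gz} \<Longrightarrow> P (inv\<^bsub>BG\<^esub> h)"
    and "\<And>f g. f \<in> CG \<Longrightarrow> g \<in> CG \<Longrightarrow> P f \<Longrightarrow> P g \<Longrightarrow> P (f \<otimes>\<^bsub>BG\<^esub> g)"
  shows "P f"
  using assms(1)[unfolded cubic_group_def]
proof (induction rule: generate.induct)
  case (eng h1 h2)
  then show ?case using assms(5) by (simp add: cubic_group_def)
qed (use assms in auto)

text \<open>The matrix with rows \<open>(a, b)\<close> and \<open>(c, d)\<close> lifts
  \<open>f\<close> to the parameters. Its negative lifts \<open>f\<close> as well, by
  \<open>cayley_param_minus\<close>.\<close>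

definition integral_lift :: "(complex^3 \<Rightarrow> complex^3) \<Rightarrow> int \<Rightarrow> int \<Rightarrow> int \<Rightarrow> int \<Rightarrow> bool" where
  "integral_lift f a b c d \<longleftrightarrow> (\<forall>s t. f (cayley_param s t) =
     cayley_param (of_int a * s + of_int b * t) (of_int c * s + of_int d * t))"

text \<open>A matrix of determinant 1 is inverted by its adjugate, which is again integral.\<close>

lemma integral_lift_inv:
  assumes "f \<in> CG" "integral_lift f a b c d" "a * d - b * c = 1"
  shows "integral_lift (inv\<^bsub>BG\<^esub> f) d (- b) (- c) a"
  unfolding integral_lift_def
proof (intro allI)
  fix s t :: complex
  let ?s = "of_int d * s - of_int b * t" and ?t = "- of_int c * s + of_int a * t"
  have det: "of_int a * of_int d - of_int b * of_int c = (1::complex)"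
    using assms(3) by (metis of_int_1 of_int_diff of_int_mult)
  have "of_int a * ?s + of_int b * ?t = (of_int a * of_int d - of_int b * of_int c) * s"
    "of_int c * ?s + of_int d * ?t = (of_int a * of_int d - of_int b * of_int c) * t"
    by (simp_all add: algebra_simps)
  then have "f (cayley_param ?s ?t) = cayley_param s t"
    using assms(2) unfolding integral_lift_def det by simp
  then show "(inv\<^bsub>BG\<^esub> f) (cayley_param s t) =
      cayley_param (of_int d * s + of_int (- b) * t) (of_int (- c) * s + of_int a * t)"
    using inv_CG_eq[OF assms(1) cayley_param_in, of ?s ?t] by simp
qed

lemma integral_lift_gen:
  "integral_lift gx 1 0 2 1" "integral_lift gy 1 (-2) 0 1" "integral_lift gz (-1) (-2) 2 3"
  by (simp_all add: integral_lift_def gen_cayley_param algebra_simps)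

lemma CG_integral_lift:
  assumes "f \<in> CG" shows "\<exists>a b c d. integral_lift f a b c d"
  using assms
proof (induction rule: CG_induct)
  case one
  have "integral_lift \<one>\<^bsub>BG\<^esub> 1 0 0 1" by (simp add: integral_lift_def one_BG)
  then show ?case by blast
next
  case (gen h)
  then show ?case using integral_lift_gen by blast
next
  case (inv_gen h)
  then show ?case
    using integral_lift_inv[OF gen_in_CG(1) integral_lift_gen(1)]
      integral_lift_inv[OF gen_in_CG(2) integral_lift_gen(2)]
      integral_lift_inv[OF gen_in_CG(3) integral_lift_gen(3)] by auto
next
  case (mult f g)
  then obtain a b c d a' b' c' d' where
    "integral_lift f a b c d" "integral_lift g a' b' c' d'" by blast
  then have "integral_lift (f \<otimes>\<^bsub>BG\<^esub> g)
      (a * a' + b * c') (a * b' + b * d') (c * a' + d * c') (c * b' + d * d')"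
    using mult.hyps by (simp add: integral_lift_def mult_CG algebra_simps)
  then show ?case by blast
qed

section \<open>Continuity of the group elements on the surface\<close>

lemma continuous_on_vector_3:
  fixes f g h :: "'a::topological_space \<Rightarrow> 'b::{topological_space,zero}"
  assumes "continuous_on S f" "continuous_on S g" "continuous_on S h"
  shows "continuous_on S (\<lambda>x. vector [f x, g x, h x] :: 'b^3)"
proof -
  have "continuous_on S (\<lambda>x. (vector [f x, g x, h x] :: 'b^3) $ i)" for i
    using assms exhaust_3[of i] by auto
  then have "continuous_on S (\<lambda>x. \<chi> i. (vector [f x, g x, h x] :: 'b^3) $ i)"
    by (rule continuous_on_vec_lambda)
  then show ?thesis by (simp add: vec_nth_inverse)
qed

lemma continuous_on_inv:
  "continuous_on S (inv_x A)" "continuous_on S (inv_y A)" "continuous_on S (inv_z A)"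
  unfolding inv_x_def inv_y_def inv_z_def
  by (intro continuous_on_vector_3 continuous_intros)+

lemma continuous_on_CG:
  assumes "f \<in> CG" shows "continuous_on cayley f"
  using assms
proof (induction rule: CG_induct)
  case one
  show ?case unfolding one_BG by (simp cong: continuous_on_cong)
next
  case (gen h)
  have "continuous_on cayley (inv_z 0 \<circ> inv_y 0)" "continuous_on cayley (inv_x 0 \<circ> inv_z 0)"
    "continuous_on cayley (inv_y 0 \<circ> inv_x 0)"
    by (intro continuous_on_compose continuous_on_inv)+
  then have "continuous_on cayley gx" "continuous_on cayley gy" "continuous_on cayley gz"
    unfolding gen_x_def gen_y_def gen_z_def by (auto elim!: continuous_on_eq)
  then show ?case using gen by blast
next
  case (inv_gen h)
  \<comment> \<open>The group inverse is given abstractly, so its continuity is read off from an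
    explicit right inverse \<open>k\<close>: the same two involutions in the opposite order.\<close>
  have *: "continuous_on cayley (inv\<^bsub>BG\<^esub> h)"
    if "h \<in> CG" "continuous_on cayley k" "\<And>p. p \<in> cayley \<Longrightarrow> k p \<in> cayley \<and> h (k p) = p" for h k
    by (rule continuous_on_eq[OF that(2)]) (use inv_CG_eq[OF that(1)] that(3) in metis)
  have "continuous_on cayley (inv\<^bsub>BG\<^esub> gx)"
    by (rule *[OF gen_in_CG(1) continuous_on_compose[OF continuous_on_inv(3)[where A = 0]
            continuous_on_inv(2)[where A = 0]]]) (auto simp: gen_x_def inv_in_cubic_surface)
  moreover have "continuous_on cayley (inv\<^bsub>BG\<^esub> gy)"
    by (rule *[OF gen_in_CG(2) continuous_on_compose[OF continuous_on_inv(1)[where A = 0]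
            continuous_on_inv(3)[where A = 0]]]) (auto simp: gen_y_def inv_in_cubic_surface)
  moreover have "continuous_on cayley (inv\<^bsub>BG\<^esub> gz)"
    by (rule *[OF gen_in_CG(3) continuous_on_compose[OF continuous_on_inv(2)[where A = 0]
            continuous_on_inv(1)[where A = 0]]]) (auto simp: gen_z_def inv_in_cubic_surface)
  ultimately show ?case using inv_gen by blast
next
  case (mult f g)
  have "continuous_on cayley (f \<circ> g)"
    using mult CG_maps by (intro continuous_on_compose) (auto intro: continuous_on_subset)
  then show ?case
    by (rule continuous_on_eq) (simp add: mult_CG mult.hyps)
qed

section \<open>The Fatou set is empty\<close>

text \<open>Precomposition with \<open>\<gamma>\<close> turns a sequence \<open>f n\<close> near
  \<open>\<gamma> p\<close> into another sequence of group elements near \<open>p\<close>, where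
  normality supplies the subsequence.\<close>

lemma fatou_CG:
  assumes \<gamma>: "\<gamma> \<in> CG" and p: "p \<in> fatou_set 0 0 0 4"
  shows "\<gamma> p \<in> fatou_set 0 0 0 4"
proof -
  define \<delta> where "\<delta> = inv\<^bsub>BG\<^esub> \<gamma>"
  have \<delta>: "\<delta> \<in> CG" "\<And>p. p \<in> cayley \<Longrightarrow> \<gamma> (\<delta> p) = p"
    using inv_CG[OF \<gamma>] by (auto simp: \<delta>_def)
  obtain U where U: "openin (top_of_set cayley) U" "p \<in> U" "normal_on 0 0 0 4 U"
    using p by (auto simp: fatou_set_def)
  have pS: "p \<in> cayley" using U by (meson openin_imp_subset subsetD)
  \<comment> \<open>This is the image of \<open>U\<close> under \<open>\<gamma>\<close>, written as
    a preimage under the inverse so that continuity makes it open.\<close>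
  define U' where "U' = cayley \<inter> \<delta> -` U"
  have "openin (top_of_set cayley) U'"
    unfolding U'_def
    by (rule continuous_openin_preimage[OF continuous_on_CG[OF \<delta>(1)] _ U(1)])
      (use CG_maps[OF \<delta>(1)] in auto)
  moreover have "\<gamma> p \<in> U'"
    using inv_CG_eq[OF \<gamma> pS refl] U CG_maps[OF \<gamma> pS] by (simp add: U'_def \<delta>_def)
  moreover have "normal_on 0 0 0 4 U'"
    unfolding normal_on_def
  proof (intro allI impI)
    fix f :: "nat \<Rightarrow> complex^3 \<Rightarrow> complex^3" assume f: "range f \<subseteq> CG"
    have "range (\<lambda>n. f n \<otimes>\<^bsub>BG\<^esub> \<gamma>) \<subseteq> CG"
      using f mult_CG(1)[OF _ \<gamma>] by blast
    then obtain r :: "nat \<Rightarrow> nat" where r: "strict_mono r" and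
      alt: "(\<exists>g. converges_locally_uniformly_on U ((\<lambda>n. f n \<otimes>\<^bsub>BG\<^esub> \<gamma>) \<circ> r) g) \<or>
        converges_to_infinity_on cayley U ((\<lambda>n. f n \<otimes>\<^bsub>BG\<^esub> \<gamma>) \<circ> r)"
      using U(3) unfolding normal_on_def by blast
    have eq: "(f n \<otimes>\<^bsub>BG\<^esub> \<gamma>) (\<delta> q) = f n q" if "q \<in> U'" for n q
    proof -
      have "f n \<in> CG" "q \<in> cayley" using f that by (auto simp: U'_def)
      then show ?thesis using mult_CG(2)[OF _ \<gamma>] CG_maps[OF \<delta>(1)] \<delta>(2) by simp
    qed
    have V: "compact (\<delta> ` V) \<and> \<delta> ` V \<subseteq> U" if "compact V" "V \<subseteq> U'" for V
      using that continuous_on_CG[OF \<delta>(1)]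
      by (auto simp: U'_def intro!: compact_continuous_image dest: continuous_on_subset)
    from alt have "(\<exists>g. converges_locally_uniformly_on U' (f \<circ> r) g) \<or>
        converges_to_infinity_on cayley U' (f \<circ> r)"
    proof
      assume "\<exists>g. converges_locally_uniformly_on U ((\<lambda>n. f n \<otimes>\<^bsub>BG\<^esub> \<gamma>) \<circ> r) g"
      then obtain g where g: "converges_locally_uniformly_on U ((\<lambda>n. f n \<otimes>\<^bsub>BG\<^esub> \<gamma>) \<circ> r) g" ..
      have "uniform_limit V (f \<circ> r) (g \<circ> \<delta>) sequentially" if "compact V" "V \<subseteq> U'" for V
      proof -
        have "uniform_limit (\<delta> ` V) ((\<lambda>n. f n \<otimes>\<^bsub>BG\<^esub> \<gamma>) \<circ> r) g sequentially"
          using g V[OF that] by (simp add: converges_locally_uniformly_on_def)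
        then have "uniform_limit V (\<lambda>n q. (f (r n) \<otimes>\<^bsub>BG\<^esub> \<gamma>) (\<delta> q)) (g \<circ> \<delta>) sequentially"
          by (simp add: uniform_limit_iff)
        moreover have "uniform_limit V (f \<circ> r) (g \<circ> \<delta>) sequentially \<longleftrightarrow>
            uniform_limit V (\<lambda>n q. (f (r n) \<otimes>\<^bsub>BG\<^esub> \<gamma>) (\<delta> q)) (g \<circ> \<delta>) sequentially"
          by (rule uniform_limit_cong') (use eq[OF subsetD[OF that(2)]] in simp_all)
        ultimately show ?thesis by blast
      qed
      then show ?thesis by (auto simp: converges_locally_uniformly_on_def)
    next
      assume inf: "converges_to_infinity_on cayley U ((\<lambda>n. f n \<otimes>\<^bsub>BG\<^esub> \<gamma>) \<circ> r)"
      have "finite {i. (f \<circ> r) i ` V \<inter> K \<noteq> {}}"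
        if "compact V" "V \<subseteq> U'" "compact K" "K \<subseteq> cayley" for V K
      proof -
        have "(f \<circ> r) i ` V = ((\<lambda>n. f n \<otimes>\<^bsub>BG\<^esub> \<gamma>) \<circ> r) i ` \<delta> ` V" for i
          unfolding image_comp using eq[OF subsetD[OF that(2)]] by (intro image_cong) simp_all
        moreover have "finite {i. ((\<lambda>n. f n \<otimes>\<^bsub>BG\<^esub> \<gamma>) \<circ> r) i ` \<delta> ` V \<inter> K \<noteq> {}}"
          using inf V[OF that(1,2)] that(3,4) unfolding converges_to_infinity_on_def by blast
        ultimately show ?thesis by simp
      qed
      then show ?thesis by (auto simp: converges_to_infinity_on_def)
    qed
    with r show "\<exists>r::nat \<Rightarrow> nat. strict_mono r \<and>
        ((\<exists>g. converges_locally_uniformly_on U' (f \<circ> r) g) \<or>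
          converges_to_infinity_on cayley U' (f \<circ> r))" by blast
  qed
  ultimately show ?thesis by (auto simp: fatou_set_def)
qed

lemma cayley_param_nbhd:
  assumes U: "openin (top_of_set cayley) U" "cayley_param s t \<in> U"
  obtains \<delta> where "\<delta> > 0"
    "\<And>s' t'. dist s' s < \<delta> \<Longrightarrow> dist t' t < \<delta> \<Longrightarrow> cayley_param s' t' \<in> U"
proof -
  obtain T where T: "open T" "U = cayley \<inter> T" using U by (auto simp: openin_open)
  define h where "h = (\<lambda>z. cayley_param (fst z) (snd z))"
  have "continuous_on UNIV h"
    unfolding h_def cayley_param_def
    by (intro continuous_on_vector_3 continuous_intros)
  then have "open (h -` T)" using T by (simp add: open_vimage)
  moreover have "(s, t) \<in> h -` T" using U T by (simp add: h_def)
  ultimately obtain A B where AB: "open A" "open B" "(s, t) \<in> A \<times> B" "A \<times> B \<subseteq> h -` T"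
    by (rule open_prod_elim)
  obtain d where d: "d > 0" "\<And>s'. dist s' s < d \<Longrightarrow> s' \<in> A"
    using AB by (auto simp: open_dist)
  obtain e where e: "e > 0" "\<And>t'. dist t' t < e \<Longrightarrow> t' \<in> B"
    using AB by (auto simp: open_dist)
  show ?thesis
  proof (rule that)
    show "min d e > 0" using d e by simp
    fix s' t' assume "dist s' s < min d e" "dist t' t < min d e"
    then have "(s', t') \<in> h -` T" using d e AB by auto
    then show "cayley_param s' t' \<in> U" by (simp add: h_def T)
  qed
qed

section \<open>Bounds for the parametrization in terms of real parts\<close>

lemma norm_cosh_le: "norm (cosh (z::complex)) \<le> cosh (Re z)"
proof -
  have "norm (cosh z) = norm (exp z + exp (- z)) / 2"
    by (simp add: cosh_def norm_divide)
  also have "norm (exp z + exp (- z)) \<le> norm (exp z) + norm (exp (- z))" by (rule norm_triangle_ineq)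
  finally show ?thesis by (simp add: cosh_def)
qed

text \<open>A linear lower bound suffices, since powers of a transvection move the parameters
  linearly. For \<open>Re z \<ge> 0\<close> it follows from \<open>exp x \<ge> 1 + x\<close> and
  \<open>exp (- x) \<le> 1\<close>.\<close>

lemma norm_cosh_ge: "\<bar>Re z\<bar> \<le> 2 * norm (cosh (z::complex))"
proof -
  have *: "Re z \<le> 2 * norm (cosh z)" if "Re z \<ge> 0" for z
  proof -
    have "exp (Re z) - exp (- Re z) \<le> norm (exp z + exp (- z))"
      using norm_triangle_ineq2[of "exp z" "- exp (- z)"] by simp
    also have "\<dots> = 2 * norm (cosh z)" by (simp add: cosh_def norm_divide)
    finally show ?thesis
      using exp_ge_add_one_self[of "Re z"] that exp_le_one_iff[of "- Re z"] by linarith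
  qed
  show ?thesis using *[of z] *[of "- z"] by (cases "Re z \<ge> 0") auto
qed

lemma norm_cayley_param_ge:
  "\<bar>Re s\<bar> \<le> norm (cayley_param s t)" "\<bar>Re t\<bar> \<le> norm (cayley_param s t)"
  using norm_cosh_ge[of s] norm_cosh_ge[of t]
    Finite_Cartesian_Product.norm_nth_le[of "cayley_param s t" 1]
    Finite_Cartesian_Product.norm_nth_le[of "cayley_param s t" 2]
  by (simp_all add: norm_mult)

lemma norm_vec3_le: "norm (p :: complex^3) \<le> norm (p$1) + norm (p$2) + norm (p$3)"
  unfolding norm_vec_def using L2_set_le_sum[of UNIV "\<lambda>i. norm (p$i)"] by (simp add: sum_3)

lemma closed_cayley: "closed cayley"
proof -
  have "closed {p::complex^3. (p$1)^2 + (p$2)^2 + (p$3)^2 + p$1 * p$2 * p$3 = 4}"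
    by (intro closed_Collect_eq continuous_intros)
  then show ?thesis by (simp add: cubic_surface_def)
qed

lemma converges_locally_uniformly_on_imp_tendsto:
  assumes "converges_locally_uniformly_on U f g" "q \<in> U"
  shows "(\<lambda>n. f n q) \<longlonglongrightarrow> g q"
proof -
  have "uniform_limit {q} f g sequentially"
    using assms unfolding converges_locally_uniformly_on_def
    by (meson compact_sing empty_subsetI insert_subset)
  then show ?thesis by (rule tendsto_uniform_limitI) simp
qed

text \<open>Both alternatives of normality fail along every subsequence: the bounded orbit of
  \<open>p\<close> meets one compact set infinitely often, and at some \<open>q\<close> in any
  neighborhood the values grow without bound, so they cannot converge.\<close>

lemma julia_setI:
  assumes p: "p \<in> cayley" and f: "range f \<subseteq> CG"
    and bdd: "\<And>n. norm (f n p) \<le> R"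
    and unb: "\<And>U. openin (top_of_set cayley) U \<Longrightarrow> p \<in> U \<Longrightarrow>
      \<exists>q\<in>U. \<exists>x y. y > 0 \<and> (\<forall>n. norm (f n q) \<ge> y * real n - x)"
  shows "p \<in> julia_set 0 0 0 4"
proof (rule ccontr)
  assume "p \<notin> julia_set 0 0 0 4"
  then obtain U where U: "openin (top_of_set cayley) U" "p \<in> U" "normal_on 0 0 0 4 U"
    using p by (auto simp: julia_set_def fatou_set_def)
  then obtain r :: "nat \<Rightarrow> nat" where r: "strict_mono r" and
    alt: "(\<exists>g. converges_locally_uniformly_on U (f \<circ> r) g) \<or>
      converges_to_infinity_on cayley U (f \<circ> r)"
    using f unfolding normal_on_def by blast
  from alt show False
  proof
    assume "\<exists>g. converges_locally_uniformly_on U (f \<circ> r) g"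
    then obtain g where g: "converges_locally_uniformly_on U (f \<circ> r) g" ..
    obtain q x y where q: "q \<in> U" "y > 0" "\<And>n. norm (f n q) \<ge> y * real n - x"
      using unb U by blast
    have "(\<lambda>n. (f \<circ> r) n q) \<longlonglongrightarrow> g q"
      by (rule converges_locally_uniformly_on_imp_tendsto[OF g q(1)])
    then obtain B where B: "\<And>n. norm ((f \<circ> r) n q) \<le> B"
      by (metis Bseq_def convergentI convergent_imp_Bseq)
    obtain n :: nat where n: "real n > (B + x) / y" using reals_Archimedean2 by blast
    have "B + x < y * real n" using n q(2) by (simp add: field_simps)
    \<comment> \<open>Growth survives the passage to a subsequence because
      \<open>n \<le> r n\<close>.\<close>
    also have "\<dots> \<le> y * real (r n)" using q(2) seq_suble[OF r, of n] by simp
    finally show False using q(3)[of "r n"] B[of n] by simp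
  next
    assume inf: "converges_to_infinity_on cayley U (f \<circ> r)"
    have "compact (cball 0 R \<inter> cayley)" by (intro compact_Int_closed closed_cayley) simp
    then have "finite {i. (f \<circ> r) i ` {p} \<inter> (cball 0 R \<inter> cayley) \<noteq> {}}"
      using inf U(2) unfolding converges_to_infinity_on_def
      by (metis compact_sing empty_subsetI inf_le2 insert_subset)
    moreover have "(f \<circ> r) i ` {p} \<inter> (cball 0 R \<inter> cayley) \<noteq> {}" for i
      using bdd f CG_maps[OF _ p] by auto
    ultimately show False by simp
  qed
qed

text \<open>The form \<open>\<alpha> * s + \<beta> * t\<close> is preserved because
  \<open>\<alpha> * a + \<beta> * b = 0\<close>, so the \<open>k\<close>-th power displaces
  \<open>(s, t)\<close> by \<open>k\<close> times its value times \<open>(a, b)\<close>. If the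
  value is purely imaginary, the real parts stay put and the orbit is bounded; otherwise a real part
  drifts linearly.\<close>

lemma julia_parabolic:
  fixes a b \<alpha> \<beta> :: real
  assumes g: "g \<in> CG"
    and lift: "\<And>s t. g (cayley_param s t) = cayley_param (s + of_real a * (of_real \<alpha> * s + of_real \<beta> * t))
      (t + of_real b * (of_real \<alpha> * s + of_real \<beta> * t))"
    and inv: "\<alpha> * a + \<beta> * b = 0" and nz: "a \<noteq> 0 \<or> b \<noteq> 0" "\<alpha> \<noteq> 0 \<or> \<beta> \<noteq> 0"
    and re: "\<alpha> * Re s + \<beta> * Re t = 0"
  shows "cayley_param s t \<in> julia_set 0 0 0 4"
proof -
  define l :: "complex \<Rightarrow> complex \<Rightarrow> complex" where "l s t = of_real \<alpha> * s + of_real \<beta> * t" for s t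
  define f where "f k = g [^]\<^bsub>BG\<^esub> (k::nat)" for k
  have f: "f k \<in> CG" for k
    unfolding f_def
    by (induction k) (use subgroup.one_closed[OF subgroup_CG] mult_CG(1) g in auto)
  have l: "l (s + of_real (c * a) * z) (t + of_real (c * b) * z) = l s t" for s t z c
  proof -
    have "l (s + of_real (c * a) * z) (t + of_real (c * b) * z)
        = l s t + of_real c * of_real (\<alpha> * a + \<beta> * b) * z"
      by (simp add: l_def algebra_simps)
    then show ?thesis by (simp add: inv)
  qed
  have fk: "f k (cayley_param s t) =
      cayley_param (s + of_real (real k * a) * l s t) (t + of_real (real k * b) * l s t)" for k s t
  proof (induction k arbitrary: s t)
    case 0
    then show ?case by (simp add: f_def one_BG)
  next
    case (Suc k)
    have "f (Suc k) (cayley_param s t) = f k (g (cayley_param s t))"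
      using mult_CG(2)[OF f g cayley_param_in] by (simp add: f_def)
    also have "g (cayley_param s t) =
        cayley_param (s + of_real (1 * a) * l s t) (t + of_real (1 * b) * l s t)"
      using lift by (simp add: l_def)
    finally show ?case unfolding Suc l by (simp add: algebra_simps)
  qed
  define R where "R = 2 * cosh (Re s) + 2 * cosh (Re t) + 2 * cosh (Re (s + t))"
  show ?thesis
  proof (rule julia_setI[of _ f R])
    show "range f \<subseteq> CG" using f by blast
    have "Re (l s t) = 0" using re by (simp add: l_def)
    then have *: "Re (s + of_real (c * a) * l s t) = Re s" "Re (t + of_real (c * b) * l s t) = Re t" for c
      by simp_all
    show "norm (f k (cayley_param s t)) \<le> R" for k
    proof -
      define s' t' where "s' = s + of_real (real k * a) * l s t" "t' = t + of_real (real k * b) * l s t"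
      have "norm (cayley_param s' t') \<le> 2 * norm (cosh s') + 2 * norm (cosh t') + 2 * norm (cosh (s' + t'))"
        using norm_vec3_le[of "cayley_param s' t'"] by (simp add: norm_mult)
      also have "\<dots> \<le> R"
      proof -
        have "Re s' = Re s" "Re t' = Re t" unfolding s'_t'_def by (rule *)+
        then show ?thesis
          using norm_cosh_le[of s'] norm_cosh_le[of t'] norm_cosh_le[of "s' + t'"]
          by (simp add: R_def)
      qed
      finally show ?thesis by (simp add: fk s'_t'_def)
    qed
  next
    fix U assume "openin (top_of_set cayley) U" "cayley_param s t \<in> U"
    then obtain \<delta> where \<delta>: "\<delta> > 0"
      "\<And>s' t'. dist s' s < \<delta> \<Longrightarrow> dist t' t < \<delta> \<Longrightarrow> cayley_param s' t' \<in> U"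
      by (rule cayley_param_nbhd) blast
    define e where "e = \<delta> / (2 * (\<bar>\<alpha>\<bar> + \<bar>\<beta>\<bar>))"
    have pos: "\<bar>\<alpha>\<bar> + \<bar>\<beta>\<bar> > 0" using nz by linarith
    have e: "e > 0" using \<delta> pos by (simp add: e_def)
    have e': "e * (\<bar>\<alpha>\<bar> + \<bar>\<beta>\<bar>) = \<delta> / 2" using pos unfolding e_def by (simp add: field_simps)
    then have e'': "e * \<bar>\<alpha>\<bar> < \<delta>" "e * \<bar>\<beta>\<bar> < \<delta>"
      using \<delta>(1) e mult_nonneg_nonneg[of e "\<bar>\<alpha>\<bar>"] mult_nonneg_nonneg[of e "\<bar>\<beta>\<bar>"]
      unfolding distrib_left by linarith+
    \<comment> \<open>A small step in the direction \<open>(\<alpha>, \<beta>)\<close> raises the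
      real part of the form from 0 to \<open>e * (\<alpha>\<^sup>2 + \<beta>\<^sup>2)\<close>, which
      is positive; \<open>e\<close> keeps both shifts below \<open>\<delta>\<close>.\<close>
    define s' t' where "s' = s + of_real (e * \<alpha>)" "t' = t + of_real (e * \<beta>)"
    have "cayley_param s' t' \<in> U"
      by (rule \<delta>(2)) (use e e'' in \<open>simp_all add: s'_t'_def dist_norm norm_mult\<close>)
    moreover have "\<exists>x y. y > 0 \<and> (\<forall>n. norm (f n (cayley_param s' t')) \<ge> y * real n - x)"
    proof -
      define c where "c = e * (\<alpha>\<^sup>2 + \<beta>\<^sup>2)"
      have c: "c > 0" using e nz by (simp add: c_def sum_power2_gt_zero_iff)
      have rl: "Re (l s' t') = c"
        using re by (simp add: l_def s'_t'_def c_def algebra_simps power2_eq_square)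
      have ge: "norm (f n (cayley_param s' t')) \<ge> \<bar>Re s' + real n * (a * c)\<bar>"
        "norm (f n (cayley_param s' t')) \<ge> \<bar>Re t' + real n * (b * c)\<bar>" for n
        using norm_cayley_param_ge[where s = "s' + of_real (real n * a) * l s' t'"
            and t = "t' + of_real (real n * b) * l s' t'"]
        by (simp_all add: fk rl mult.assoc)
      have lin: "\<bar>x + real n * y\<bar> \<ge> \<bar>y\<bar> * real n - \<bar>x\<bar>" for n x y
        using abs_triangle_ineq2[of "real n * y" "- x"] by (simp add: abs_mult mult.commute add.commute)
      from nz(1) show ?thesis
      proof
        assume "a \<noteq> 0"
        then show ?thesis using c ge(1) lin[where x = "Re s'" and y = "a * c"]
          by (intro exI[of _ "\<bar>Re s'\<bar>"] exI[of _ "\<bar>a * c\<bar>"]) (auto intro: order_trans)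
      next
        assume "b \<noteq> 0"
        then show ?thesis using c ge(2) lin[where x = "Re t'" and y = "b * c"]
          by (intro exI[of _ "\<bar>Re t'\<bar>"] exI[of _ "\<bar>b * c\<bar>"]) (auto intro: order_trans)
      qed
    qed
    ultimately show "\<exists>q\<in>U. \<exists>x y. y > 0 \<and> (\<forall>n. norm (f n q) \<ge> y * real n - x)" by blast
  qed simp
qed

lemma julia_base:
  "Re s = 0 \<Longrightarrow> cayley_param s t \<in> julia_set 0 0 0 4"
  "Re t = 0 \<Longrightarrow> cayley_param s t \<in> julia_set 0 0 0 4"
  "Re s + Re t = 0 \<Longrightarrow> cayley_param s t \<in> julia_set 0 0 0 4"
proof -
  \<comment> \<open>Here and in the next two cases the four numbers stand for \<open>a\<close>,
    \<open>\<alpha>\<close>, \<open>\<beta>\<close>, \<open>b\<close> in this order.\<close>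
  show "Re s = 0 \<Longrightarrow> cayley_param s t \<in> julia_set 0 0 0 4"
    by (rule julia_parabolic[OF gen_in_CG(1), of 0 1 0 2]) (simp_all add: gen_cayley_param)
  show "Re t = 0 \<Longrightarrow> cayley_param s t \<in> julia_set 0 0 0 4"
    by (rule julia_parabolic[OF gen_in_CG(2), of "-2" 0 1 0]) (simp_all add: gen_cayley_param)
  show "Re s + Re t = 0 \<Longrightarrow> cayley_param s t \<in> julia_set 0 0 0 4"
    by (rule julia_parabolic[OF gen_in_CG(3), of "-2" 1 1 2]) (simp_all add: gen_cayley_param)
qed

section \<open>Euclidean descent on grid points, and their density\<close>

lemma julia_CG:
  assumes "\<gamma> \<in> CG" "p \<in> cayley" "\<gamma> p \<in> julia_set 0 0 0 4"
  shows "p \<in> julia_set 0 0 0 4"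
  using assms fatou_CG[of \<gamma> p] by (auto simp: julia_set_def)

lemma inv_gen_cayley_param:
  "(inv\<^bsub>BG\<^esub> gx) (cayley_param s t) = cayley_param s (t - 2 * s)"
  "(inv\<^bsub>BG\<^esub> gy) (cayley_param s t) = cayley_param (s + 2 * t) t"
  using integral_lift_inv[OF gen_in_CG(1) integral_lift_gen(1)]
    integral_lift_inv[OF gen_in_CG(2) integral_lift_gen(2)]
  by (simp_all add: integral_lift_def)

text \<open>Integer matrices keep the grid of mesh \<open>1 / N\<close>, so induction on
  \<open>\<bar>m\<bar> + \<bar>n\<bar>\<close> is available; \<open>julia_CG\<close> carries
  membership back along each move.\<close>

lemma julia_grid:
  fixes m n :: int
  assumes "N * Re s = of_int m" "N * Re t = of_int n" "N > 0"
  shows "cayley_param s t \<in> julia_set 0 0 0 4"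
  using assms
proof (induction "nat (\<bar>m\<bar> + \<bar>n\<bar>)" arbitrary: m n s t rule: less_induct)
  case less
  have step: ?case if "\<gamma> \<in> CG" "\<gamma> (cayley_param s t) = cayley_param s' t'"
    "N * Re s' = of_int m'" "N * Re t' = of_int n'" "\<bar>m'\<bar> + \<bar>n'\<bar> < \<bar>m\<bar> + \<bar>n\<bar>" for \<gamma> s' t' m' n'
    using julia_CG[OF that(1) cayley_param_in] less.hyps[of m' n' s' t'] that less.prems by simp
  \<comment> \<open>If both entries are nonzero and differ in absolute value, adding or subtracting
    twice the smaller strictly shrinks the larger. Descent stalls only at a zero entry or at
    \<open>m = n\<close>, \<open>m = - n\<close>.\<close>
  consider "m = 0" | "n = 0" | "m = n" | "m + n = 0"
    | "\<bar>m - 2 * n\<bar> < \<bar>m\<bar>" | "\<bar>m + 2 * n\<bar> < \<bar>m\<bar>" | "\<bar>n - 2 * m\<bar> < \<bar>n\<bar>" | "\<bar>n + 2 * m\<bar> < \<bar>n\<bar>"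
    by linarith
  then show ?case
  proof cases
    case 1
    then show ?thesis using less.prems by (intro julia_base(1)) simp
  next
    case 2
    then show ?thesis using less.prems by (intro julia_base(2)) simp
  next
    case 3
    \<comment> \<open>One more application of \<open>gy\<close> sends real parts
      \<open>(r, r)\<close> to \<open>(- r, r)\<close>, where the third base case applies.\<close>
    then have "Re s = Re t" using less.prems by (metis mult_cancel_left less_irrefl)
    then have "gy (cayley_param s t) \<in> julia_set 0 0 0 4"
      unfolding gen_cayley_param by (intro julia_base(3)) simp
    then show ?thesis by (rule julia_CG[OF gen_in_CG(2) cayley_param_in])
  next
    case 4
    then have "N * (Re s + Re t) = 0"
      using less.prems by (simp add: distrib_left flip: of_int_add)
    then show ?thesis using less.prems by (intro julia_base(3)) simp
  next
    case 5
    show ?thesis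
      by (rule step[OF gen_in_CG(2) gen_cayley_param(2), of "m - 2 * n" n])
        (use less.prems 5 in \<open>simp_all add: algebra_simps\<close>)
  next
    case 6
    show ?thesis
      by (rule step[OF inv_CG(1)[OF gen_in_CG(2)] inv_gen_cayley_param(2), of "m + 2 * n" n])
        (use less.prems 6 in \<open>simp_all add: algebra_simps\<close>)
  next
    case 7
    show ?thesis
      by (rule step[OF inv_CG(1)[OF gen_in_CG(1)] inv_gen_cayley_param(1), of m "n - 2 * m"])
        (use less.prems 7 in \<open>simp_all add: algebra_simps\<close>)
  next
    case 8
    show ?thesis
      by (rule step[OF gen_in_CG(1) gen_cayley_param(1), of m "n + 2 * m"])
        (use less.prems 8 in \<open>simp_all add: algebra_simps\<close>)
  qed
qed

text \<open>Three points, so that a matrix acting on each of them by a sign is itself a sign.\<close>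

lemma cayley_grid_points:
  assumes U: "openin (top_of_set cayley) U" "U \<noteq> {}"
  obtains N :: real and m n :: int and s t :: complex where "N > 0" "m \<noteq> 0" "n \<noteq> 0" "m + n + 1 \<noteq> 0"
    "N * Re s = of_int m" "N * Re t = of_int n"
    "cayley_param s t \<in> U" "cayley_param (s + of_real (1 / N)) t \<in> U"
    "cayley_param s (t + of_real (1 / N)) \<in> U"
proof -
  obtain p where "p \<in> U" using U by blast
  moreover have "p \<in> cayley" using U \<open>p \<in> U\<close> by (meson openin_imp_subset subsetD)
  ultimately obtain s0 t0 where "cayley_param s0 t0 \<in> U" using cayley_param_surj by metis
  with U(1) obtain \<delta> where \<delta>: "\<delta> > 0"
    "\<And>s' t'. dist s' s0 < \<delta> \<Longrightarrow> dist t' t0 < \<delta> \<Longrightarrow> cayley_param s' t' \<in> U"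
    by (rule cayley_param_nbhd) blast
  \<comment> \<open>Rounding the real parts costs at most \<open>3 / N\<close> and the later shift
    \<open>1 / N\<close>, so \<open>4 / N < \<delta>\<close> is what is required.\<close>
  define N where "N = 5 / \<delta>"
  have N: "N > 0" "4 / N < \<delta>" using \<delta>(1) by (simp_all add: N_def)
  define k l where "k = \<lfloor>N * Re s0\<rfloor>" "l = \<lfloor>N * Re t0\<rfloor>"
  \<comment> \<open>Start from the floors. Avoiding 0 moves \<open>m\<close> by at most 1; then two
    values are forbidden for \<open>n\<close>, so one of \<open>l\<close>, \<open>l + 1\<close>,
    \<open>l + 2\<close> is free.\<close>
  obtain m n where mn: "m \<noteq> 0" "n \<noteq> 0" "m + n + 1 \<noteq> 0" "k \<le> m" "m \<le> k + 1" "l \<le> n" "n \<le> l + 2"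
  proof -
    define m where "m = (if k = 0 then 1 else k)"
    have "\<exists>n. n \<noteq> 0 \<and> m + n + 1 \<noteq> 0 \<and> l \<le> n \<and> n \<le> l + 2" by presburger
    then show ?thesis using that[of m] by (auto simp: m_def split: if_splits)
  qed
  define s t where "s = s0 + of_real (of_int m / N - Re s0)" "t = t0 + of_real (of_int n / N - Re t0)"
  have bd: "\<bar>of_int m / N - Re s0\<bar> \<le> 2 / N" "\<bar>of_int n / N - Re t0\<bar> \<le> 3 / N"
  proof -
    have "\<bar>of_int m - N * Re s0\<bar> \<le> 2" "\<bar>of_int n - N * Re t0\<bar> \<le> 3"
      using mn unfolding k_l_def by linarith+
    moreover have "of_int m / N - Re s0 = (of_int m - N * Re s0) / N"
      "of_int n / N - Re t0 = (of_int n - N * Re t0) / N"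
      using N by (simp_all add: field_simps)
    ultimately show "\<bar>of_int m / N - Re s0\<bar> \<le> 2 / N" "\<bar>of_int n / N - Re t0\<bar> \<le> 3 / N"
      using N by (simp_all add: abs_divide divide_right_mono)
  qed
  have b2: "2 / N \<le> 3 / N" "3 / N + 1 / N = 4 / N" "1 / N > 0" using N by (simp_all add: field_simps)
  have d0: "dist s s0 \<le> 3 / N" "dist t t0 \<le> 3 / N"
    using bd b2 by (auto simp only: s_t_def dist_norm add_diff_cancel_left' norm_of_real)
  have n1: "norm (complex_of_real (1 / N)) = 1 / N" unfolding norm_of_real using N by simp
  have d1: "dist (s + of_real (1 / N)) s0 \<le> 4 / N" "dist (t + of_real (1 / N)) t0 \<le> 4 / N"
    using d0 b2 n1 norm_triangle_ineq[of "s - s0" "of_real (1 / N)"]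
      norm_triangle_ineq[of "t - t0" "of_real (1 / N)"]
    unfolding dist_norm by (simp_all add: algebra_simps)
  show ?thesis
  proof (rule that[of N m n s t])
    show "N * Re s = of_int m" "N * Re t = of_int n" using N by (simp_all add: s_t_def)
    show "cayley_param s t \<in> U" "cayley_param (s + of_real (1 / N)) t \<in> U"
      "cayley_param s (t + of_real (1 / N)) \<in> U"
      by (rule \<delta>(2); use d0 d1 b2 N(2) in linarith)+
  qed (use N mn in auto)
qed

text \<open>An open set of normality lies wholly in the Fatou set, yet it contains a grid point,
  which belongs to the Julia set.\<close>

lemma fatou_empty: "fatou_set 0 0 0 4 = {}"
proof (rule ccontr)
  assume "fatou_set 0 0 0 4 \<noteq> {}"
  then obtain p U where U: "openin (top_of_set cayley) U" "p \<in> U" "normal_on 0 0 0 4 U"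
    by (auto simp: fatou_set_def)
  then have "U \<subseteq> fatou_set 0 0 0 4" by (auto simp: fatou_set_def)
  moreover obtain N m n s t where "N > 0" "N * Re s = of_int m" "N * Re t = of_int n"
    "cayley_param s t \<in> U"
    using cayley_grid_points U by (metis empty_iff)
  then have "cayley_param s t \<in> U \<inter> julia_set 0 0 0 4" using julia_grid by blast
  ultimately show False by (auto simp: julia_set_def)
qed

section \<open>Local discreteness\<close>

text \<open>Since \<open>2 * cosh s \<plusminus> 2\<close> are \<open>(2 * cosh (s / 2))\<^sup>2\<close> and \<open>(2 * sinh (s / 2))\<^sup>2\<close>, the lines
  \<open>Re s = const\<close> are mapped by \<open>-2 * cosh\<close> to ellipses with foci \<open>2\<close> and \<open>-2\<close>.\<close>

lemma norm_cosh_foci: "norm (-2 * cosh s - 2) + norm (-2 * cosh s + 2) = 4 * cosh (Re s)"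
  for s :: complex
proof -
  \<comment> \<open>Half exponentials make both distances squares of \<open>norm (a + b)\<close> and
    \<open>norm (a - b)\<close>, and the parallelogram law adds them up.\<close>
  define a b where "a = exp (s / 2)" "b = exp (- (s / 2))"
  have ab: "a * b = 1" "a ^ 2 = exp s" "b ^ 2 = exp (- s)"
    by (simp_all add: a_b_def power2_eq_square flip: exp_add)
  have n: "norm (a ^ 2) = exp (Re s)" "norm (b ^ 2) = exp (- Re s)" by (simp_all add: ab)
  have "2 * cosh s = exp s + exp (- s)" by (simp add: cosh_def scaleR_conv_of_real)
  then have "-2 * cosh s - 2 = - ((a + b) ^ 2)" "-2 * cosh s + 2 = - ((a - b) ^ 2)"
    using ab by algebra+
  then have "norm (-2 * cosh s - 2) + norm (-2 * cosh s + 2) = norm (a + b) ^ 2 + norm (a - b) ^ 2"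
    by (simp only: norm_minus_cancel norm_power)
  also have "\<dots> = 2 * norm (a ^ 2) + 2 * norm (b ^ 2)"
    unfolding norm_power cmod_power2 by (simp add: power2_eq_square algebra_simps)
  also have "\<dots> = 4 * cosh (Re s)" unfolding n by (simp add: cosh_def)
  finally show ?thesis .
qed

text \<open>By \<open>norm_cosh_foci\<close>, \<open>cosh (Re z)\<close> depends continuously on
  \<open>-2 * cosh z\<close>, and \<open>arcosh\<close> recovers the absolute value. The case
  \<open>Re w = 0\<close> needs continuity of \<open>arcosh\<close> at its endpoint 1.\<close>

lemma tendsto_abs_Re:
  fixes z :: "nat \<Rightarrow> complex"
  assumes "(\<lambda>n. -2 * cosh (z n)) \<longlonglongrightarrow> -2 * cosh w"
  shows "(\<lambda>n. \<bar>Re (z n)\<bar>) \<longlonglongrightarrow> \<bar>Re w\<bar>"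
proof -
  have "(\<lambda>n. (norm (-2 * cosh (z n) - 2) + norm (-2 * cosh (z n) + 2)) / 4)
      \<longlonglongrightarrow> (norm (-2 * cosh w - 2) + norm (-2 * cosh w + 2)) / 4"
    by (intro tendsto_intros assms) simp
  then have "(\<lambda>n. cosh (Re (z n))) \<longlonglongrightarrow> cosh (Re w)"
    unfolding norm_cosh_foci by simp
  then have "(\<lambda>n. arcosh (cosh (Re (z n)))) \<longlonglongrightarrow> arcosh (cosh (Re w))"
    by (rule tendsto_arcosh_strong) (simp_all add: cosh_real_ge_1)
  moreover have "arcosh (cosh x) = \<bar>x\<bar>" for x :: real
    using arcosh_cosh_real[of "\<bar>x\<bar>"] by simp
  ultimately show ?thesis by simp
qed

lemma eventually_eq_of_tendsto_int:
  fixes k :: "nat \<Rightarrow> int"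
  assumes "(\<lambda>n. real_of_int (k n)) \<longlonglongrightarrow> of_int l"
  shows "\<forall>\<^sub>F n in sequentially. k n = l"
  by (rule eventually_mono[OF tendstoD[OF assms, of 1]])
    (auto simp: dist_real_def simp flip: of_int_diff)

text \<open>Scaled by \<open>N\<close>, the real parts of all images are integers, and by
  \<open>tendsto_abs_Re\<close> their absolute values converge, hence are eventually
  constant.\<close>

lemma integral_lift_grid_fixed:
  fixes a b c d :: "nat \<Rightarrow> int" and m n :: int
  assumes lift: "\<And>k. integral_lift (f k) (a k) (b k) (c k) (d k)"
    and lim: "(\<lambda>k. f k (cayley_param s t)) \<longlonglongrightarrow> cayley_param s t"
    and N: "N > 0" "N * Re s = of_int m" "N * Re t = of_int n"
  shows "\<forall>\<^sub>F k in sequentially.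
    (a k * m + b k * n = m \<and> c k * m + d k * n = n) \<or>
    (a k * m + b k * n = - m \<and> c k * m + d k * n = - n)"
proof -
  define x y where "x k = of_int (a k) * s + of_int (b k) * t" "y k = of_int (c k) * s + of_int (d k) * t" for k
  have "(\<lambda>k. cayley_param (x k) (y k)) \<longlonglongrightarrow> cayley_param s t"
    using lim lift by (simp add: integral_lift_def x_y_def)
  then have lim_i: "(\<lambda>k. cayley_param (x k) (y k) $ i) \<longlonglongrightarrow> cayley_param s t $ i" for i
    by (rule tendsto_vec_nth)
  have ev: "\<forall>\<^sub>F k in sequentially. \<bar>j k\<bar> = \<bar>l\<bar>"
    if "(\<lambda>k. -2 * cosh (z k)) \<longlonglongrightarrow> -2 * cosh w" "\<And>k. N * Re (z k) = of_int (j k)" "N * Re w = of_int l"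
    for z w and j :: "nat \<Rightarrow> int" and l
  proof (rule eventually_eq_of_tendsto_int)
    have "(\<lambda>k. N * \<bar>Re (z k)\<bar>) \<longlonglongrightarrow> N * \<bar>Re w\<bar>"
      by (intro tendsto_intros tendsto_abs_Re that)
    moreover have "N * \<bar>r\<bar> = \<bar>N * r\<bar>" for r using N by (simp add: abs_mult)
    ultimately show "(\<lambda>k. real_of_int \<bar>j k\<bar>) \<longlonglongrightarrow> of_int \<bar>l\<bar>"
      using that by simp
  qed
  have x: "N * Re (x k) = of_int (a k * m + b k * n)" for k
    unfolding x_y_def using N by (simp add: algebra_simps flip: N(2,3))
  have y: "N * Re (y k) = of_int (c k * m + d k * n)" for k
    unfolding x_y_def using N by (simp add: algebra_simps flip: N(2,3))
  have "\<forall>\<^sub>F k in sequentially. \<bar>a k * m + b k * n\<bar> = \<bar>m\<bar>"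
    using ev[OF _ x N(2)] lim_i[of 1] by simp
  moreover have "\<forall>\<^sub>F k in sequentially. \<bar>c k * m + d k * n\<bar> = \<bar>n\<bar>"
    using ev[OF _ y N(3)] lim_i[of 2] by simp
  \<comment> \<open>The first two coordinates fix each entry up to its own sign; the third forces
    the two signs to agree.\<close>
  moreover have "\<forall>\<^sub>F k in sequentially. \<bar>(a k * m + b k * n) + (c k * m + d k * n)\<bar> = \<bar>m + n\<bar>"
    by (rule ev[of "\<lambda>k. x k + y k" "s + t"])
      (use lim_i[of 3] x y N in \<open>simp_all add: distrib_left\<close>)
  ultimately show ?thesis
    by eventually_elim arith
qed

lemma locally_discrete_cayley:
  assumes U: "openin (top_of_set cayley) U" "U \<noteq> {}"
  shows "locally_discrete_on 0 0 0 4 U"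
proof
  assume "locally_nondiscrete_on 0 0 0 4 U"
  then obtain f where f: "range f \<subseteq> CG - {\<one>\<^bsub>BG\<^esub>}" "converges_locally_uniformly_on U f (\<lambda>p. p)"
    by (auto simp: locally_nondiscrete_on_def)
  then have fC: "f k \<in> CG" "f k \<noteq> \<one>\<^bsub>BG\<^esub>" for k by auto
  then obtain a b c d where lift: "\<And>k. integral_lift (f k) (a k) (b k) (c k) (d k)"
  proof -
    have "\<forall>k. \<exists>a b c d. integral_lift (f k) a b c d" using CG_integral_lift fC(1) by blast
    then show ?thesis using that unfolding choice_iff by blast
  qed
  obtain N :: real and m n :: int and s t where N: "N > 0" "m \<noteq> 0" "n \<noteq> 0" "m + n + 1 \<noteq> 0"
    "N * Re s = of_int m" "N * Re t = of_int n" and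
    inU: "cayley_param s t \<in> U" "cayley_param (s + of_real (1 / N)) t \<in> U"
    "cayley_param s (t + of_real (1 / N)) \<in> U"
    using U by (rule cayley_grid_points)
  have N': "N * Re (s + of_real (1 / N)) = of_int (m + 1)" "N * Re (t + of_real (1 / N)) = of_int (n + 1)"
    using N by (simp_all add: distrib_left)
  note ev = integral_lift_grid_fixed[OF lift converges_locally_uniformly_on_imp_tendsto[OF f(2)] N(1)]
  have "\<forall>\<^sub>F k in sequentially. (a k = 1 \<and> b k = 0 \<and> c k = 0 \<and> d k = 1) \<or>
      (a k = -1 \<and> b k = 0 \<and> c k = 0 \<and> d k = -1)"
    using ev[OF inU(1) N(5,6)] ev[OF inU(2) N'(1) N(6)] ev[OF inU(3) N(5) N'(2)]
  proof eventually_elim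
    case (elim k)
    \<comment> \<open>Cramer's rule: a row is determined by its values on two linearly independent
      vectors.\<close>
    have row: "p = q \<and> r = 0" if "p * x + r * y = q * x" "p * x' + r * y' = q * x'" "x * y' \<noteq> x' * y"
      for p q r x y x' y' :: int
    proof -
      have "(p - q) * (x * y' - x' * y) = 0" "r * (x * y' - x' * y) = 0"
        using that(1,2) by algebra+
      then show ?thesis using that(3) by simp
    qed
    have sgn: "a k = q \<and> b k = 0 \<and> c k = 0 \<and> d k = q"
      if "a k * x + b k * y = q * x" "c k * x + d k * y = q * y"
        "a k * x' + b k * y' = q * x'" "c k * x' + d k * y' = q * y'" "x * y' \<noteq> x' * y" for q x y x' y'
      using row[of "a k" x "b k" y q x' y'] row[of "d k" y "c k" x q y' x'] that
      by (auto simp: algebra_simps)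
    \<comment> \<open>The three grid vectors are pairwise independent, with determinants
      \<open>n\<close>, \<open>m\<close> and \<open>m + n + 1\<close> up to sign.\<close>
    have det: "m * n \<noteq> (m + 1) * n" "m * (n + 1) \<noteq> m * n" "(m + 1) * (n + 1) \<noteq> m * n"
      using N(2-4) by (auto simp: algebra_simps)
    define P where "P q x y \<longleftrightarrow> a k * x + b k * y = q * x \<and> c k * x + d k * y = q * y" for q x y
    have "P 1 m n \<or> P (-1) m n" "P 1 (m + 1) n \<or> P (-1) (m + 1) n" "P 1 m (n + 1) \<or> P (-1) m (n + 1)"
      using elim by (simp_all add: P_def)
    \<comment> \<open>Pigeonhole: three points and two signs, so two of the points share a sign
      \<open>q\<close>.\<close>
    then have "\<exists>q\<in>{1, -1}. P q m n \<and> P q (m + 1) n \<or> P q m n \<and> P q m (n + 1) \<or>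
        P q (m + 1) n \<and> P q m (n + 1)" by blast
    then obtain q where q: "q = 1 \<or> q = -1" "P q m n \<and> P q (m + 1) n \<or> P q m n \<and> P q m (n + 1) \<or>
        P q (m + 1) n \<and> P q m (n + 1)" by blast
    from q(2) have "a k = q \<and> b k = 0 \<and> c k = 0 \<and> d k = q"
      unfolding P_def
      using sgn[of m n q "m + 1" n] sgn[of m n q m "n + 1"] sgn[of "m + 1" n q m "n + 1"] det by blast
    then show ?case using q(1) by auto
  qed
  then obtain k where "(a k = 1 \<and> b k = 0 \<and> c k = 0 \<and> d k = 1) \<or>
      (a k = -1 \<and> b k = 0 \<and> c k = 0 \<and> d k = -1)"
    using eventually_happens trivial_limit_sequentially by blast
  then have "f k (cayley_param s t) = cayley_param s t" for s t
    using lift[of k] cayley_param_minus by (auto simp: integral_lift_def)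
  then have "f k p = p" if "p \<in> cayley" for p using cayley_param_surj[OF that] by metis
  then show False using CG_eq_one[OF fC(1)] fC(2) by blast
qed

section \<open>Hyperbolic stabilizers\<close>

lemma exp_eq_of_cosh_eq:
  fixes z w :: complex
  assumes "cosh w = cosh z" shows "exp w = exp z \<or> exp w = exp (- z)"
proof -
  have "(exp w - exp z) * (exp w - exp (- z)) = 2 * exp w * (cosh w - cosh z)"
    by (simp add: cosh_def scaleR_conv_of_real algebra_simps flip: exp_add)
  then show ?thesis using assms by simp
qed

text \<open>The first two coordinates allow independent signs. In a mixed case the third makes
  \<open>exp s\<close> or \<open>exp t\<close> equal to its own inverse, so that sign may be
  switched to match the other.\<close>

lemma cayley_param_eqD:
  assumes "cayley_param s' t' = cayley_param s t"
  shows "(exp s' = exp s \<and> exp t' = exp t) \<or> (exp s' = exp (- s) \<and> exp t' = exp (- t))"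
proof -
  have c: "cosh s' = cosh s" "cosh t' = cosh t" "cosh (s' + t') = cosh (s + t)"
    using arg_cong[OF assms, of "\<lambda>p. p $ 1"] arg_cong[OF assms, of "\<lambda>p. p $ 2"]
      arg_cong[OF assms, of "\<lambda>p. p $ 3"] by simp_all
  have "exp s' * exp t' = exp s * exp t \<or> exp s' * exp t' = exp (- s) * exp (- t)"
    using exp_eq_of_cosh_eq[OF c(3)] by (simp add: minus_add_distrib flip: exp_add)
  then show ?thesis
    using exp_eq_of_cosh_eq[OF c(1)] exp_eq_of_cosh_eq[OF c(2)]
    by (metis exp_not_eq_zero mult_cancel_left mult_cancel_right)
qed

lemma cayley_param_exp_cong:
  assumes "exp s' = exp s" "exp t' = exp t"
  shows "cayley_param s' t' = cayley_param s t"
proof -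
  have "cosh s' = cosh s" "cosh t' = cosh t" "cosh (s' + t') = cosh (s + t)"
    unfolding cosh_def exp_minus exp_add assms by simp_all
  then show ?thesis by (simp add: cayley_param_def)
qed

lemma has_vector_derivative_vecI:
  fixes f :: "real \<Rightarrow> 'a::real_normed_vector^'n"
  assumes "\<And>i. ((\<lambda>x. f x $ i) has_vector_derivative w $ i) (at x)"
  shows "(f has_vector_derivative w) (at x)"
proof -
  have "((\<lambda>y. (1 / norm (y - x)) *\<^sub>R (f y - (f x + (y - x) *\<^sub>R w))) \<longlongrightarrow> 0) (at x)"
    by (rule vec_tendstoI)
      (use assms in \<open>simp add: has_vector_derivative_def has_derivative_within\<close>)
  then show ?thesis
    by (simp add: has_vector_derivative_def has_derivative_within bounded_linear_scaleR_left)
qed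

lemma polynomial_fun_differentiable: "polynomial_fun h \<Longrightarrow> h differentiable (at p)"
proof (induction rule: polynomial_fun.induct)
  case (coord i)
  show ?case by (rule bounded_linear_imp_differentiable) (rule bounded_linear_vec_nth)
qed (auto intro: differentiable_add differentiable_mult)

text \<open>Polynomials vanishing on \<open>S\<close> vanish along the curve, so \<open>w\<close> is
  a Zariski tangent vector, even at a singular point. Differentiating the fixed curve gives
  \<open>L w = w\<close>, an eigenvalue of modulus 1.\<close>

lemma hyperbolic_on_cayley_not_fixing_curve:
  assumes p: "\<phi> 0 = p" and \<phi>: "\<And>x. \<phi> x \<in> S" "(\<phi> has_vector_derivative w) (at 0)" "w \<noteq> 0"
    and fixed: "\<And>x. \<gamma> (\<phi> x) = \<phi> x"
    and L: "has_regular_derivative \<gamma> L S p"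
  shows "\<not> hyperbolic_on (zariski_tangent_space S p) L"
proof -
  obtain f where f: "\<forall>q\<in>S. f q = \<gamma> q" "(f has_derivative L) (at p)"
    using L by (auto simp: has_regular_derivative_def)
  have chain: "((g \<circ> \<phi>) has_vector_derivative g' w) (at 0)" if "(g has_derivative g') (at p)" for g g'
    by (rule vector_derivative_diff_chain_within[OF \<phi>(2)])
      (use that p in \<open>auto intro: has_derivative_at_withinI\<close>)
  have "f \<circ> \<phi> = \<phi>" using f(1) \<phi>(1) fixed by auto
  then have "L w = w"
    using chain[OF f(2)] \<phi>(2) vector_derivative_unique_at by metis
  moreover have "w \<in> zariski_tangent_space S p"
    unfolding zariski_tangent_space_def
  proof (intro CollectI allI impI, elim conjE)
    fix h assume h: "polynomial_fun h" "\<forall>q\<in>S. h q = 0"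
    have "(h has_derivative frechet_derivative h (at p)) (at p)"
      using polynomial_fun_differentiable[OF h(1)] frechet_derivative_works by blast
    moreover have "h \<circ> \<phi> = (\<lambda>_. 0)" using h(2) \<phi>(1) by auto
    ultimately show "frechet_derivative h (at p) w = 0"
      using chain has_vector_derivative_const vector_derivative_unique_at by metis
  qed
  ultimately show ?thesis
    using \<phi>(3) unfolding hyperbolic_on_def by (metis norm_one vector_smult_lid)
qed

lemma closed_real_cube: "closed real_cube"
proof -
  have "closed (complex_of_real ` {-2..2})"
    by (intro compact_imp_closed compact_continuous_image continuous_intros) simp
  then have "closed ((\<lambda>p::complex^3. p $ i) -` complex_of_real ` {-2..2})" for i
    by (rule closed_vimage) (intro continuous_intros)
  then have "closed (\<Inter>i. (\<lambda>p::complex^3. p $ i) -` complex_of_real ` {-2..2})"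
    by (intro closed_INT ballI)
  moreover have "real_cube = (\<Inter>i. (\<lambda>p. p $ i) -` complex_of_real ` {-2..2})"
    by (auto simp: real_cube_def)
  ultimately show ?thesis by (simp only:)
qed

lemma cayley_param_in_real_cube:
  assumes "Re s = 0" "Re t = 0" shows "cayley_param s t \<in> real_cube"
proof -
  have "-2 * cosh z \<in> complex_of_real ` {-2..2}" if "Re z = 0" for z
  proof (rule image_eqI)
    show "-2 * cosh z = complex_of_real (-2 * cos (Im z))"
      using that by (simp add: complex_eq_iff cosh_def Re_exp Im_exp)
    show "-2 * cos (Im z) \<in> {-2..2}"
      using cos_ge_minus_one[of "Im z"] cos_le_one[of "Im z"]
      unfolding atLeastAtMost_iff by linarith
  qed
  then show ?thesis using assms by (simp add: real_cube_def forall_3)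
qed

lemma has_vector_derivative_cosh_line:
  "((\<lambda>x. -2 * cosh (z + of_real x * r)) has_vector_derivative -2 * sinh z * r) (at 0)"
  for z r :: complex
proof -
  have "((\<lambda>x. -2 * cosh (z + x * r)) has_field_derivative -2 * sinh z * r) (at (of_real 0))"
    by (auto intro!: derivative_eq_intros)
  then show ?thesis by (rule has_vector_derivative_real_field)
qed

lemma Re_eq_of_exp_eq: "exp z = exp w \<Longrightarrow> Re z = Re w"
  using norm_exp_eq_Re[of z] norm_exp_eq_Re[of w] by simp

lemma sinh_neq_0: "sinh z \<noteq> 0" if "Re z \<noteq> 0" for z :: complex
proof
  assume "sinh z = 0"
  then have "exp z = exp (- z)" by (simp add: sinh_def)
  then have "norm (exp z) = norm (exp (- z))" by simp
  then show False using that by simp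
qed

lemma hyperbolic_stabilizer_in_real_cube: "hyperbolic_stabilizer_set 0 0 0 4 \<subseteq> real_cube"
proof
  fix p assume "p \<in> hyperbolic_stabilizer_set 0 0 0 4"
  then obtain \<gamma> L where p: "p \<in> cayley" and \<gamma>: "\<gamma> \<in> CG" "\<gamma> p = p"
    and L: "has_regular_derivative \<gamma> L cayley p" "hyperbolic_on (zariski_tangent_space cayley p) L"
    by (auto simp: hyperbolic_stabilizer_set_def julia_set_def)
  obtain s t where st: "p = cayley_param s t" using p cayley_param_surj by blast
  obtain a b c d where lift: "integral_lift \<gamma> a b c d" using CG_integral_lift[OF \<gamma>(1)] by blast
  define s' t' where "s' = of_int a * s + of_int b * t" "t' = of_int c * s + of_int d * t"
  have "cayley_param s' t' = cayley_param s t"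
    using \<gamma>(2) lift by (simp add: st integral_lift_def s'_t'_def)
  note sgn = cayley_param_eqD[OF this]
  \<comment> \<open>Equal exponentials have equal real parts, so the matrix fixes
    \<open>(Re s, Re t)\<close> exactly up to sign, although it fixes \<open>(s, t)\<close> only
    modulo periods. Real multiples of this vector may therefore be added.\<close>
  define \<phi> :: "real \<Rightarrow> complex^3" where
    "\<phi> x = cayley_param (s + of_real x * of_real (Re s)) (t + of_real x * of_real (Re t))" for x
  have fixed: "\<gamma> (\<phi> x) = \<phi> x" for x
  proof -
    have "\<gamma> (\<phi> x) = cayley_param (s' + of_real (x * Re s')) (t' + of_real (x * Re t'))"
      using lift by (simp add: \<phi>_def integral_lift_def s'_t'_def algebra_simps)
    also have "\<dots> = \<phi> x"
      using sgn
    proof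
      assume e: "exp s' = exp s \<and> exp t' = exp t"
      then have "Re s' = Re s" "Re t' = Re t" by (auto intro: Re_eq_of_exp_eq)
      then show ?thesis
        unfolding \<phi>_def using e by (intro cayley_param_exp_cong) (simp_all add: exp_add)
    next
      \<comment> \<open>The added vector is negated together with \<open>(s, t)\<close>, so the sign
        change is absorbed by \<open>cayley_param_minus\<close>.\<close>
      assume e: "exp s' = exp (- s) \<and> exp t' = exp (- t)"
      then have "Re s' = Re (- s)" "Re t' = Re (- t)" by (blast intro: Re_eq_of_exp_eq)+
      then show ?thesis
        unfolding \<phi>_def cayley_param_minus[of "s + _", symmetric] using e
        by (intro cayley_param_exp_cong) (simp_all add: exp_add exp_diff exp_minus field_simps)
    qed
    finally show ?thesis .
  qed
  define w :: "complex^3" where "w = vector [-2 * sinh s * of_real (Re s), -2 * sinh t * of_real (Re t),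
    -2 * sinh (s + t) * of_real (Re (s + t))]"
  have "((\<lambda>x. \<phi> x $ i) has_vector_derivative w $ i) (at 0)" for i
    using exhaust_3[of i] has_vector_derivative_cosh_line[of s "of_real (Re s)"]
      has_vector_derivative_cosh_line[of t "of_real (Re t)"]
      has_vector_derivative_cosh_line[of "s + t" "of_real (Re (s + t))"]
    by (auto simp: \<phi>_def w_def algebra_simps)
  then have \<phi>: "(\<phi> has_vector_derivative w) (at 0)" by (rule has_vector_derivative_vecI)
  \<comment> \<open>Hyperbolicity forces zero velocity. Since \<open>sinh\<close> has no zeros off
    the imaginary axis, both real parts then vanish.\<close>
  have "w = 0"
  proof (rule ccontr)
    assume "w \<noteq> 0"
    have "\<not> hyperbolic_on (zariski_tangent_space cayley p) L"
      by (rule hyperbolic_on_cayley_not_fixing_curve[OF _ _ \<phi> \<open>w \<noteq> 0\<close> fixed L(1)])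
        (simp_all add: \<phi>_def st)
    then show False using L(2) by blast
  qed
  then have "w $ 1 = 0" "w $ 2 = 0" by simp_all
  then have "Re s = 0" "Re t = 0" using sinh_neq_0 by (auto simp: w_def)
  then show "p \<in> real_cube" unfolding st by (rule cayley_param_in_real_cube)
qed

theorem theoremD:
  shows "(julia_set 0 0 0 4 = cubic_surface 0 0 0 4 \<and> fatou_set 0 0 0 4 = {}) \<and>
    (\<forall>U. openin (top_of_set (cubic_surface 0 0 0 4)) U \<and> U \<noteq> {} \<longrightarrow>
         locally_discrete_on 0 0 0 4 U) \<and>
    (closure (hyperbolic_stabilizer_set 0 0 0 4) \<subseteq> cubic_surface 0 0 0 4 \<inter> real_cube \<and>
     closure (hyperbolic_stabilizer_set 0 0 0 4) \<subset> julia_set 0 0 0 4)"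
proof -
  have julia: "julia_set 0 0 0 4 = cayley" by (simp add: julia_set_def fatou_empty)
  have "hyperbolic_stabilizer_set 0 0 0 4 \<subseteq> cayley \<inter> real_cube"
    using hyperbolic_stabilizer_in_real_cube by (auto simp: hyperbolic_stabilizer_set_def julia)
  then have cl: "closure (hyperbolic_stabilizer_set 0 0 0 4) \<subseteq> cayley \<inter> real_cube"
    by (rule closure_minimal) (intro closed_Int closed_cayley closed_real_cube)
  \<comment> \<open>This is \<open>cayley_param (ln 2) 0\<close>, a point of the surface outside the
    cube, which makes the inclusion proper.\<close>
  define q :: "complex^3" where "q = vector [-5/2, -2, -5/2]"
  have "q \<in> cayley" by (simp add: q_def in_cayley_iff power2_eq_square)
  moreover have "q \<notin> real_cube"
  proof
    assume "q \<in> real_cube"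
    then have "q $ 1 \<in> complex_of_real ` {-2..2}" by (simp add: real_cube_def)
    then obtain x where "x \<in> {-2..2}" "-5/2 = complex_of_real x" by (auto simp: q_def)
    then show False by (auto dest: arg_cong[where f = Re])
  qed
  ultimately show ?thesis
    using julia fatou_empty cl locally_discrete_cayley by blast
qed

end
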